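(* For the path $P_n$ on $n\ge 2$ vertices, \[\operatorname{fp}(P_n)=\left\lceil\frac{n-1}{3}\right\rceil\quad\text{and}\quad \nu_{\operatorname{ind}}(P_n)=\left\lceil\frac{n-1}{3}\right\rceil.\] In particular $\operatorname{fp}(P_n)=\nu_{\operatorname{ind}}(P_n)$ for all $n\ge 2$.
   Context: A bipartite graph is a Ferrers graph if it contains no induced copy of $2K_2$ (two disjoint edges with no other edges among their four endpoints). For a bipartite graph $G=(U,V,E)$, $\operatorname{fp}(G)$ is the minimum $k$ such that $E$ can be partitioned into $k$ sets $E_i$ with each spanning subgraph $(U,V,E_i)$ a Ferrers graph. An induced matching is a matching $M$ such that for any two distinct edges $uv,u'v'\in M$ the only edges of the graph among $\{u,v,u',v'\}$ are $uv,u'v'$; $\nu_{\operatorname{ind}}(G)$ is the maximum size of an induced matching. $P_n$ is the path on $n$ vertices. *)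

theory Defs
  imports Complex_Main "HOL-Library.Disjoint_Sets"
begin

definition bipartite_graph :: "'a set \<Rightarrow> 'a set \<Rightarrow> 'a set set \<Rightarrow> bool" where
  "bipartite_graph U V E \<longleftrightarrow>
     finite U \<and> finite V \<and> U \<inter> V = {} \<and> E \<subseteq> {{u, v} | u v. u \<in> U \<and> v \<in> V}"

text \<open>Disjoint edges \<open>e\<close>, \<open>f\<close> that are the only edges among their four endpoints,
  i.e. an induced copy of \<open>2K\<^sub>2\<close>.\<close>

definition induces_2K2 :: "'a set set \<Rightarrow> 'a set \<Rightarrow> 'a set \<Rightarrow> bool" where
  "induces_2K2 E e f \<longleftrightarrow>
     e \<in> E \<and> f \<in> E \<and> e \<inter> f = {} \<and> (\<forall>g\<in>E. g \<subseteq> e \<union> f \<longrightarrow> g = e \<or> g = f)"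

definition ferrers_graph :: "'a set \<Rightarrow> 'a set \<Rightarrow> 'a set set \<Rightarrow> bool" where
  "ferrers_graph U V E \<longleftrightarrow> bipartite_graph U V E \<and> \<not> (\<exists>e f. induces_2K2 E e f)"

text \<open>The classes of \<^const>\<open>partition_on\<close> are nonempty; allowing empty classes would not
  change the minimum, as dropping them leaves a smaller partition. Finiteness of \<open>P\<close> is
  explicit because \<^const>\<open>card\<close> is \<open>0\<close> on infinite sets. The minimum exists for every
  bipartite graph (lemma \<open>fp_attained\<close>).\<close>

definition fp :: "'a set \<Rightarrow> 'a set \<Rightarrow> 'a set set \<Rightarrow> nat" where
  "fp U V E =
     (LEAST k. \<exists>P. partition_on E P \<and> finite P \<and> card P = k \<and> (\<forall>F\<in>P. ferrers_graph U V F))"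

definition matching :: "'a set set \<Rightarrow> 'a set set \<Rightarrow> bool" where
  "matching E M \<longleftrightarrow> M \<subseteq> E \<and> disjoint M"

definition induced_matching :: "'a set set \<Rightarrow> 'a set set \<Rightarrow> bool" where
  "induced_matching E M \<longleftrightarrow> matching E M \<and>
     (\<forall>e\<in>M. \<forall>f\<in>M. e \<noteq> f \<longrightarrow> (\<forall>g\<in>E. g \<subseteq> e \<union> f \<longrightarrow> g = e \<or> g = f))"

definition nu_ind :: "'a set set \<Rightarrow> nat" where
  "nu_ind E = Max {card M | M. induced_matching E M}"

definition path_vertices :: "nat \<Rightarrow> nat set" where
  "path_vertices n = {0..<n}"

definition path_edges :: "nat \<Rightarrow> nat set set" where
  "path_edges n = {{i, Suc i} | i. Suc i < n}"

lemma bipartite_graph_finite_edges: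
  assumes "bipartite_graph U V E" shows "finite E"
proof (rule finite_subset)
  show "E \<subseteq> Pow (U \<union> V)" using assms by (auto simp: bipartite_graph_def)
  show "finite (Pow (U \<union> V))" using assms by (auto simp: bipartite_graph_def)
qed

lemma ferrers_graph_single_edge:
  assumes "bipartite_graph U V E" "e \<in> E" shows "ferrers_graph U V {e}"
  using assms by (auto simp: ferrers_graph_def bipartite_graph_def induces_2K2_def)

lemma fp_attained:
  assumes "bipartite_graph U V E"
  shows "\<exists>P. partition_on E P \<and> finite P \<and> card P = fp U V E \<and> (\<forall>F\<in>P. ferrers_graph U V F)"
  unfolding fp_def
proof (rule LeastI_ex)
  let ?P = "(\<lambda>e. {e}) ` E"
  have "partition_on E ?P" by (auto simp: partition_on_def disjoint_def)
  moreover have "finite ?P" using bipartite_graph_finite_edges[OF assms] by simp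
  moreover have "\<forall>F\<in>?P. ferrers_graph U V F"
    using ferrers_graph_single_edge[OF assms] by blast
  ultimately show "\<exists>k P. partition_on E P \<and> finite P \<and> card P = k \<and> (\<forall>F\<in>P. ferrers_graph U V F)"
    by blast
qed

lemma nu_ind_attained:
  assumes "finite E"
  shows "\<exists>M. induced_matching E M \<and> card M = nu_ind E"
proof -
  have "{card M | M. induced_matching E M} \<subseteq> card ` Pow E"
    by (auto simp: induced_matching_def matching_def)
  then have "finite {card M | M. induced_matching E M}"
    using assms by (meson finite_Pow_iff finite_imageI finite_subset)
  moreover have "induced_matching E {}"
    by (simp add: induced_matching_def matching_def)
  ultimately have "nu_ind E \<in> {card M | M. induced_matching E M}"
    unfolding nu_ind_def by (intro Max_in) auto
  then show ?thesis by auto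
qed

lemma path_bipartition:
  "bipartite_graph {i \<in> path_vertices n. even i} {i \<in> path_vertices n. odd i} (path_edges n)"
proof -
  have "\<exists>u v. {i, Suc i} = {u, v} \<and> (u < n \<and> even u) \<and> v < n \<and> odd v" if "Suc i < n" for i
  proof (cases "even i")
    case True
    with that show ?thesis by (intro exI[of _ i] exI[of _ "Suc i"]) auto
  next
    case False
    with that show ?thesis by (intro exI[of _ "Suc i"] exI[of _ i]) auto
  qed
  then show ?thesis
    by (auto simp: bipartite_graph_def path_vertices_def path_edges_def)
qed

end

theory Submission
  imports Defs
begin

text \<open>Two edges of an induced matching cannot lie in a common Ferrers class, so
  \<open>\<nu>\<^sub>i\<^sub>n\<^sub>d \<le> fp\<close>. On \<open>P\<^sub>n\<close> taking every third edge gives an induced matching of size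
  \<open>\<lceil>(n - 1) / 3\<rceil>\<close>, while cutting the path into blocks of three consecutive edges gives a
  partition into that many Ferrers graphs, since \<open>P\<^sub>4\<close> contains no induced \<open>2K\<^sub>2\<close>.\<close>

lemma nu_ind_ge_card:
  assumes "finite E" "induced_matching E M"
  shows "card M \<le> nu_ind E"
proof -
  have "{card M | M. induced_matching E M} \<subseteq> card ` Pow E"
    by (auto simp: induced_matching_def matching_def)
  then have "finite {card M | M. induced_matching E M}"
    using assms(1) by (meson finite_Pow_iff finite_imageI finite_subset)
  then show ?thesis
    unfolding nu_ind_def using assms(2) by (intro Max_ge) auto
qed

lemma fp_le_card:
  assumes "partition_on E P" "finite P" "\<And>F. F \<in> P \<Longrightarrow> ferrers_graph U V F"
  shows "fp U V E \<le> card P"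
  unfolding fp_def by (rule Least_le) (use assms in blast)

lemma induced_matching_card_le_partition:
  assumes "induced_matching E M" "partition_on E P" "finite P"
    and ferrers: "\<And>F. F \<in> P \<Longrightarrow> ferrers_graph U V F"
  shows "card M \<le> card P"
proof -
  have "\<forall>e\<in>M. \<exists>F\<in>P. e \<in> F"
    using assms(1,2) by (auto simp: induced_matching_def matching_def partition_on_def)
  then obtain cls where cls: "\<And>e. e \<in> M \<Longrightarrow> cls e \<in> P \<and> e \<in> cls e"
    by metis
  have "inj_on cls M"
  proof (rule inj_onI, rule ccontr)
    fix e f assume ef: "e \<in> M" "f \<in> M" "cls e = cls f" "e \<noteq> f"
    have "cls e \<subseteq> E"
      using cls[OF ef(1)] assms(2) by (auto simp: partition_on_def)
    moreover have "e \<inter> f = {}"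
      using assms(1) ef by (auto simp: induced_matching_def matching_def disjoint_def)
    \<comment> \<open>Inducedness passes from \<open>E\<close> to the class: it restricts every edge
      of \<open>E\<close> inside \<open>e \<union> f\<close>, hence every edge of the subset
      \<open>cls e\<close>.\<close>
    ultimately have "induces_2K2 (cls e) e f"
      using cls ef assms(1) unfolding induces_2K2_def induced_matching_def
      by (metis subsetD)
    then show False
      using ferrers cls ef(1) by (auto simp: ferrers_graph_def)
  qed
  moreover have "cls ` M \<subseteq> P" using cls by auto
  ultimately show ?thesis
    using assms(3) card_inj_on_le by blast
qed

lemma nu_ind_le_fp:
  assumes "bipartite_graph U V E"
  shows "nu_ind E \<le> fp U V E"
  using nu_ind_attained[OF bipartite_graph_finite_edges[OF assms]] fp_attained[OF assms]
    induced_matching_card_le_partition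
  by metis

text \<open>Moves the count to natural-number division, which also numbers the chosen edges and the
  blocks. The subtraction is real, so at \<open>n = 0\<close> both sides are
  \<open>0\<close>.\<close>

lemma ceiling_path_edges:
  "\<lceil>(real n - 1) / 3\<rceil> = int ((n + 1) div 3)"
proof (rule ceiling_unique)
  have "n + 1 = 3 * ((n + 1) div 3) + (n + 1) mod 3" "(n + 1) mod 3 < 3"
    by simp_all
  then have "3 * ((n + 1) div 3) \<le> n + 1" "n + 1 < 3 * ((n + 1) div 3) + 3"
    by linarith+
  then have "3 * real ((n + 1) div 3) \<le> real n + 1" "real n + 1 < 3 * real ((n + 1) div 3) + 3"
    by linarith+
  then show "of_int (int ((n + 1) div 3)) - 1 < (real n - 1) / 3"
    "(real n - 1) / 3 \<le> of_int (int ((n + 1) div 3))"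
    by (simp_all add: field_simps)
qed

lemma nu_ind_path_ge:
  "(n + 1) div 3 \<le> nu_ind (path_edges n)"
proof -
  let ?edge = "\<lambda>j::nat. {3 * j, Suc (3 * j)}"
  \<comment> \<open>The range is exact: \<open>j < (n + 1) div 3\<close> iff
    \<open>3 * j + 1 < n\<close>, i.e. iff the right endpoint is a vertex.\<close>
  let ?M = "?edge ` {..<(n + 1) div 3}"
  have "?M \<subseteq> path_edges n"
    by (auto simp: path_edges_def)
  moreover have "disjoint ?M"
    by (auto intro!: disjointI) presburger+
  moreover have "g = ?edge i \<or> g = ?edge j"
    if g: "g \<in> path_edges n" "g \<subseteq> ?edge i \<union> ?edge j" for g i j
  proof -
    obtain l where l: "g = {l, Suc l}" using g(1) by (auto simp: path_edges_def)
    with g(2) have "l \<in> {3 * i, 3 * i + 1, 3 * j, 3 * j + 1}"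
      "Suc l \<in> {3 * i, 3 * i + 1, 3 * j, 3 * j + 1}"
      by auto
    \<comment> \<open>Both \<open>l\<close> and \<open>Suc l\<close> are 0 or 1 mod 3, which forces
      \<open>l\<close> to be 0 mod 3.\<close>
    then have "l = 3 * i \<or> l = 3 * j" by auto presburger+
    with l show ?thesis by auto
  qed
  ultimately have "induced_matching (path_edges n) ?M"
    by (auto simp: induced_matching_def matching_def)
  moreover have "card ?M = (n + 1) div 3"
    by (subst card_image) (auto simp: inj_on_def doubleton_eq_iff)
  ultimately show ?thesis
    using nu_ind_ge_card[OF bipartite_graph_finite_edges[OF path_bipartition]] by metis
qed

lemma fp_path_le:
  assumes "bipartite_graph U V (path_edges n)"
  shows "fp U V (path_edges n) \<le> (n + 1) div 3"
proof -
  let ?k = "(n + 1) div 3"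
  \<comment> \<open>An edge is sorted by its left endpoint, so a block holds at most three
    consecutive edges; only the last one can be shorter.\<close>
  define block where "block j = {{i, Suc i} | i. Suc i < n \<and> i div 3 = j}" for j
  let ?P = "block ` {..<?k}"
  have "\<Union> ?P = path_edges n"
  proof -
    have "i div 3 < ?k" if "Suc i < n" for i using that by presburger
    then show ?thesis by (fastforce simp: block_def path_edges_def)
  qed
  moreover have "block j \<noteq> {}" if "j < ?k" for j
  proof -
    \<comment> \<open>The first edge of each block exists, even when the last block is cut
      short.\<close>
    have "Suc (3 * j) < n" using that by presburger
    then have "{3 * j, Suc (3 * j)} \<in> block j" unfolding block_def by fastforce
    then show ?thesis by blast
  qed
  moreover have "disjoint ?P"
  proof -
    have "block i \<inter> block j = {}" if "i \<noteq> j" for i j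
      using that by (auto simp: block_def doubleton_eq_iff)
    then show ?thesis unfolding disjoint_def by (metis imageE)
  qed
  ultimately have "partition_on (path_edges n) ?P"
    by (auto simp: partition_on_def)
  moreover have "ferrers_graph U V (block j)" for j
  proof -
    have "block j \<subseteq> path_edges n" by (auto simp: block_def path_edges_def)
    then have "bipartite_graph U V (block j)"
      using assms by (auto simp: bipartite_graph_def)
    moreover have "\<not> induces_2K2 (block j) e f" for e f
    proof
      assume A: "induces_2K2 (block j) e f"
      then obtain a b where
        a: "e = {a, Suc a}" "Suc a < n" "a div 3 = j" and
        b: "f = {b, Suc b}" "Suc b < n" "b div 3 = j"
        unfolding induces_2K2_def block_def by blast
      \<comment> \<open>Left endpoint of the middle edge. Disjoint edges of a block must be its two
        outer ones; the middle edge then lies in \<open>e \<union> f\<close> and belongs to the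
        block, since the third edge exists. So it violates inducedness.\<close>
      define c where "c = 3 * j + 1"
      have "a \<noteq> b" "a \<noteq> Suc b" "b \<noteq> Suc a"
        using A a b by (auto simp: induces_2K2_def)
      moreover have "a = 3 * j \<or> a = 3 * j + 1 \<or> a = 3 * j + 2"
        using a(3) by presburger
      moreover have "b = 3 * j \<or> b = 3 * j + 1 \<or> b = 3 * j + 2"
        using b(3) by presburger
      ultimately have c: "a = 3 * j \<and> b = 3 * j + 2 \<or> b = 3 * j \<and> a = 3 * j + 2"
        by auto
      then have "Suc c < n" "c div 3 = j" "{c, Suc c} \<subseteq> e \<union> f"
        using a b by (auto simp: c_def)
      then have "{c, Suc c} = e \<or> {c, Suc c} = f"
        using A unfolding induces_2K2_def block_def by blast
      then show False using a(1) b(1) c by (auto simp: c_def doubleton_eq_iff)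
    qed
    ultimately show ?thesis by (simp add: ferrers_graph_def)
  qed
  ultimately have "fp U V (path_edges n) \<le> card ?P"
    by (intro fp_le_card) auto
  also have "\<dots> \<le> ?k"
    using card_image_le[of "{..<?k}" block] by simp
  finally show ?thesis .
qed

theorem theorem5p2:
  fixes n :: nat and U V :: "nat set"
  assumes "n \<ge> 2"
    and "bipartite_graph U V (path_edges n)"
    and "U \<union> V = path_vertices n"
  shows "int (fp U V (path_edges n)) = \<lceil>(real n - 1) / 3\<rceil>
       \<and> int (nu_ind (path_edges n)) = \<lceil>(real n - 1) / 3\<rceil>
       \<and> fp U V (path_edges n) = nu_ind (path_edges n)"
  \<comment> \<open>The chain \<open>(n + 1) div 3 \<le> nu_ind \<le> fp \<le> (n + 1) div 3\<close>
    collapses to equalities.\<close>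
  using nu_ind_path_ge[of n] nu_ind_le_fp[OF assms(2)] fp_path_le[OF assms(2)]
  by (simp add: ceiling_path_edges)

end
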